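(* Consider the Gaussian compression model with variance 1 and the conformity measure $A(\sigma,z):=z$, and let $p_1,p_2,\dots$ be the corresponding conformal p-values. Define $$S_n:=\begin{cases}1 & \text{if } n\le 1,\\ 1/\mathcal{N}_{0,2}([-1,1]) & \text{if } n\ge 2 \text{ and } p_2\in[\Phi(-1/\sqrt2),\Phi(1/\sqrt2)],\\ 0 & \text{if } n\ge 2\text{ and } p_2\notin[\Phi(-1/\sqrt2),\Phi(1/\sqrt2)].\end{cases}$$ Then $S=(S_n)_{n\ge0}$ is a conformal test martingale. As a function of the observations it satisfies, for $n\ge 2$, $S_n=1/\mathcal{N}_{0,2}([-1,1])$ if $Z_2-Z_1\in[-1,1]$ and $S_n=0$ otherwise. However, for every $\mu\in\mathbb{R}$, there is no natural test martingale $S^\mu$ with respect to $\mathcal{N}_{\mu,1}^\infty$ such that $S_n\le S_n^\mu$ holds everywhere on $\mathbb{R}^\infty$ for both $n=1$ and $n=2$.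
   Context: $\mathcal{N}_{\mu,\sigma^2}$ is the Gaussian distribution on $\mathbb{R}$ with mean $\mu$ and variance $\sigma^2$; $\mathcal{N}_{\mu,1}^\infty$ is the infinite product measure on $\mathbb{R}^\infty$; $\Phi$ is the standard Gaussian cumulative distribution function. The observations $Z_1,Z_2,\dots$ are the coordinate maps on $\mathbb{R}^\infty$, with realizations $z_1,z_2,\dots$. The natural filtration is $\mathcal{F}_n:=\sigma(Z_1,\dots,Z_n)$, $n=0,1,\dots$ ($\mathcal{F}_0$ is trivial). Test martingale: given a filtration $(\mathcal{G}_n)_{n\ge0}$ and a probability measure $P$, a test martingale is a nonnegative martingale $(S_n)_{n\ge0}$ with respect to $(\mathcal{G}_n)$ and $P$ with $S_0=1$. A natural test martingale with respect to $P$ is one for which the filtration is the natural filtration $(\mathcal{F}_n)$. Gaussian compression model with variance 1: the summary of $(z_1,\dots,z_n)\in\mathbb{R}^n$ is $\sigma_n:=z_1+\dots+z_n$, and for each $\sigma_n\in\mathbb{R}$, $P_n(\sigma_n)$ is the probability measure on the hyperplane $\{(z_1,\dots,z_n)\in\mathbb{R}^n: z_1+\dots+z_n=\sigma_n\}$ whose density with respect to Lebesgue measure on this hyperplane is proportional to $\exp(-\frac12\sum_{i=1}^n z_i^2)$ (for $n=1$ it is the point mass at $\sigma_1$). Let $B_{\mathbf{Z}}(\cdot\mid\sigma_n)$ denote the distribution of the last coordinate $z_n$ under $P_n(\sigma_n)$. Conformal p-values: for a measurable conformity measure $A:\mathbb{R}\times\mathbb{R}\to[-\infty,\infty]$ and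 numbers $\tau_1,\tau_2,\dots\in[0,1]$, $$p_n:=B_{\mathbf{Z}}(\{z: A(\sigma_n,z)<A(\sigma_n,z_n)\}\mid\sigma_n)+\tau_n B_{\mathbf{Z}}(\{z: A(\sigma_n,z)=A(\sigma_n,z_n)\}\mid\sigma_n).$$ Under the conformity measure $A(\sigma,z)=z$, the p-value $p_2$ does not depend on the $\tau$s, so $S_n$ above is a function of the observations only. Conformal test martingale: a process which, as a function of $(p_1,p_2,\dots)\in[0,1]^\infty$, is a test martingale with respect to the filtration $\mathcal{F}'_n:=\sigma(p_1,\dots,p_n)$ and the uniform probability measure on $[0,1]^\infty$ (under which $p_1,p_2,\dots$ are independent and uniform on $[0,1]$). *)

theory Defs
  imports "HOL-Probability.Probability"
begin

text \<open>Sequences of observations, of p-values and of tie-breaking numbers are indexed by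
  $1, 2, \dots$; they are elements of dependent function spaces over the index set \<open>{1..}\<close>
  (finite segments: over \<open>{1..n}\<close>), so the value at index $0$ is \<open>undefined\<close> and irrelevant.\<close>

text \<open>The second parameter is the variance, whereas \<^const>\<open>normal_density\<close> takes the standard
  deviation.\<close>

definition gaussian :: "real \<Rightarrow> real \<Rightarrow> real measure" where
  "gaussian \<mu> v = density lborel (normal_density \<mu> (sqrt v))"

definition gaussian_seq :: "real \<Rightarrow> (nat \<Rightarrow> real) measure" where
  "gaussian_seq \<mu> = (\<Pi>\<^sub>M i\<in>{1..}. gaussian \<mu> 1)"

definition uniform_seq :: "(nat \<Rightarrow> real) measure" where
  "uniform_seq = (\<Pi>\<^sub>M i\<in>{1..}. restrict_space lborel {0..1})"

definition std_normal_cdf :: "real \<Rightarrow> real" where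
  "std_normal_cdf = cdf (gaussian 0 1)"


section \<open>Test martingales\<close>

definition is_martingale ::
    "'a measure \<Rightarrow> (nat \<Rightarrow> 'a measure) \<Rightarrow> (nat \<Rightarrow> 'a \<Rightarrow> real) \<Rightarrow> bool" where
  "is_martingale P G S \<longleftrightarrow>
     prob_space P \<and> filtration (space P) G \<and> (\<forall>n. subalgebra P (G n)) \<and>
     (\<forall>n. S n \<in> borel_measurable (G n)) \<and> (\<forall>n. integrable P (S n)) \<and>
     (\<forall>m n. m \<le> n \<longrightarrow> (AE x in P. real_cond_exp P (G m) (S n) x = S m x))"

definition test_martingale ::
    "'a measure \<Rightarrow> (nat \<Rightarrow> 'a measure) \<Rightarrow> (nat \<Rightarrow> 'a \<Rightarrow> real) \<Rightarrow> bool" where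
  "test_martingale P G S \<longleftrightarrow>
     is_martingale P G S \<and> (\<forall>n. \<forall>x\<in>space P. 0 \<le> S n x) \<and> (\<forall>x\<in>space P. S 0 x = 1)"

definition coordinate_filtration :: "(nat \<Rightarrow> real) set \<Rightarrow> nat \<Rightarrow> (nat \<Rightarrow> real) measure" where
  "coordinate_filtration \<Omega> n =
     sigma \<Omega> {{x\<in>\<Omega>. x i \<in> B} | i B. i \<in> {1..n} \<and> B \<in> sets borel}"

definition natural_test_martingale ::
    "(nat \<Rightarrow> real) measure \<Rightarrow> (nat \<Rightarrow> (nat \<Rightarrow> real) \<Rightarrow> real) \<Rightarrow> bool" where
  "natural_test_martingale P S \<longleftrightarrow> test_martingale P (coordinate_filtration (space P)) S"

text \<open>Here \<open>S n\<close> is given as a function of the sequence $(p_1, p_2, \dots) \in [0,1]^\infty$.\<close>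

definition conformal_test_martingale :: "(nat \<Rightarrow> (nat \<Rightarrow> real) \<Rightarrow> real) \<Rightarrow> bool" where
  "conformal_test_martingale S \<longleftrightarrow>
     test_martingale uniform_seq (coordinate_filtration (space uniform_seq)) S"


section \<open>The Gaussian compression model with variance 1\<close>

definition summary :: "nat \<Rightarrow> (nat \<Rightarrow> real) \<Rightarrow> real" where
  "summary n z = (\<Sum>i\<in>{1..n}. z i)"

definition hyperplane :: "nat \<Rightarrow> real \<Rightarrow> (nat \<Rightarrow> real) set" where
  "hyperplane n \<sigma> = {z \<in> {1..n} \<rightarrow>\<^sub>E UNIV. summary n z = \<sigma>}"

text \<open>Lebesgue measure on the hyperplane, for $n \ge 1$: the hyperplane is the graph of the function
  $(z_1,\dots,z_{n-1}) \mapsto \sigma - z_1 - \dots - z_{n-1}$ with constant gradient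
  $(-1,\dots,-1)$, so its area element is $\sqrt{1 + (n-1)}$ times Lebesgue measure on
  $\mathbb{R}^{n-1}$. For $n = 1$ this is the point mass at $\sigma$.\<close>

definition hyperplane_lebesgue :: "nat \<Rightarrow> real \<Rightarrow> (nat \<Rightarrow> real) measure" where
  "hyperplane_lebesgue n \<sigma> =
     scale_measure (ennreal (sqrt (real n)))
       (distr (\<Pi>\<^sub>M i\<in>{1..<n}. lborel)
              (restrict_space (\<Pi>\<^sub>M i\<in>{1..n}. borel) (hyperplane n \<sigma>))
              (\<lambda>x. x(n := \<sigma> - (\<Sum>i\<in>{1..<n}. x i))))"

definition gaussian_weight :: "nat \<Rightarrow> (nat \<Rightarrow> real) \<Rightarrow> ennreal" where
  "gaussian_weight n z = ennreal (exp (- (1/2) * (\<Sum>i\<in>{1..n}. (z i)\<^sup>2)))"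

text \<open>$P_n(\sigma)$ and the law $B_{\mathbf Z}(\cdot \mid \sigma)$ of the last coordinate under
  it.\<close>

definition compression :: "nat \<Rightarrow> real \<Rightarrow> (nat \<Rightarrow> real) measure" where
  "compression n \<sigma> =
     density (hyperplane_lebesgue n \<sigma>)
       (\<lambda>z. gaussian_weight n z / (\<integral>\<^sup>+ y. gaussian_weight n y \<partial>hyperplane_lebesgue n \<sigma>))"

definition last_coordinate_law :: "nat \<Rightarrow> real \<Rightarrow> real measure" where
  "last_coordinate_law n \<sigma> = distr (compression n \<sigma>) borel (\<lambda>z. z n)"


section \<open>Conformal p-values\<close>

definition conformal_p ::
    "(real \<Rightarrow> real \<Rightarrow> ereal) \<Rightarrow> (nat \<Rightarrow> real) \<Rightarrow> (nat \<Rightarrow> real) \<Rightarrow> nat \<Rightarrow> real" where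
  "conformal_p A z \<tau> = (\<lambda>n\<in>{1..}. let \<sigma> = summary n z; B = last_coordinate_law n \<sigma> in
     measure B {y. A \<sigma> y < A \<sigma> (z n)} + \<tau> n * measure B {y. A \<sigma> y = A \<sigma> (z n)})"

definition identity_conformity :: "real \<Rightarrow> real \<Rightarrow> ereal" where
  "identity_conformity \<sigma> z = ereal z"

definition S_conf :: "nat \<Rightarrow> (nat \<Rightarrow> real) \<Rightarrow> real" where
  "S_conf n p =
     (if n \<le> 1 then 1
      else if p 2 \<in> {std_normal_cdf (- 1 / sqrt 2) .. std_normal_cdf (1 / sqrt 2)}
        then 1 / measure (gaussian 0 2) {-1..1}
      else 0)"

text \<open>The same process as a function of the observations \<open>z\<close> (and of the tie-breaking
  numbers \<open>\<tau>\<close>, on which the p-values formally depend).\<close>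

definition S_obs :: "(nat \<Rightarrow> real) \<Rightarrow> nat \<Rightarrow> (nat \<Rightarrow> real) \<Rightarrow> real" where
  "S_obs \<tau> n z = S_conf n (conformal_p identity_conformity z \<tau>)"

end

theory Submission
  imports Defs
begin

text \<open>
  Under the summary \<open>\<sigma> = z\<^sub>1 + z\<^sub>2\<close> the second observation is Gaussian with mean \<open>\<sigma> / 2\<close> and
  variance \<open>1 / 2\<close> (\<open>last_coordinate_law_2\<close>): on the line \<open>(\<sigma> - t, t)\<close> the weight
  \<open>exp (- ((\<sigma> - t)\<^sup>2 + t\<^sup>2) / 2)\<close> is a constant times \<open>exp (- (t - \<sigma> / 2)\<^sup>2)\<close>. Ties have probability
  zero, so \<open>p\<^sub>2 = \<Phi> ((z\<^sub>2 - z\<^sub>1) / sqrt 2)\<close> (\<open>conformal_p_2\<close>), and since \<open>\<Phi>\<close> is strictly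
  increasing, the process bets on \<open>\<bar>z\<^sub>2 - z\<^sub>1\<bar> \<le> 1\<close> (\<open>S_obs_eq\<close>).

  In terms of the p-values it is a fair bet on the event that the uniform \<open>p\<^sub>2\<close>, which is independent
  of \<open>p\<^sub>1\<close>, falls into an interval of length \<open>c\<close>, where \<open>c\<close> is the mass that the law of
  \<open>z\<^sub>2 - z\<^sub>1\<close> gives to \<open>[-1, 1]\<close>; the capital is multiplied by \<open>1 / c\<close> if the event occurs
  (\<open>conformal_test_martingale_S_conf\<close>).

  The filtration of the observations is richer: at time 1 it contains \<open>z\<^sub>1\<close> itself, not just the
  uninformative \<open>p\<^sub>1\<close>. Averaged over \<open>z\<^sub>1\<close> the bet is fair, but given that \<open>z\<^sub>1\<close> is close to its mean
  \<open>\<mu>\<close>, the event \<open>\<bar>z\<^sub>2 - z\<^sub>1\<bar> \<le> 1\<close> has conditional probability greater than \<open>c\<close>. A dominating natural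
  test martingale is at least 1 at time 1 and has expectation 1, so it equals 1 almost surely at
  time 1; then on the event that \<open>z\<^sub>1\<close> is close to \<open>\<mu>\<close> it cannot grow enough on average to stay
  above the bet at time 2 (\<open>no_dominating_test_martingale\<close>).
\<close>

section \<open>Gaussian measures on the line\<close>

lemma sets_gaussian [simp, measurable_cong]: "sets (gaussian \<mu> v) = sets borel"
  by (simp add: gaussian_def)

lemma space_gaussian [simp]: "space (gaussian \<mu> v) = UNIV"
  by (simp add: gaussian_def)

lemma prob_space_gaussian: "0 < v \<Longrightarrow> prob_space (gaussian \<mu> v)"
  unfolding gaussian_def by (rule prob_space_normal_density) simp

lemma real_distribution_gaussian: "0 < v \<Longrightarrow> real_distribution (gaussian \<mu> v)"
  by (intro real_distribution.intro real_distribution_axioms.intro prob_space_gaussian) auto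

lemma emeasure_gaussian_standardize:
  assumes v: "0 < v" and A [measurable]: "A \<in> sets borel"
  shows "emeasure (gaussian \<mu> v) A = emeasure (gaussian 0 1) {t. \<mu> + sqrt v * t \<in> A}"
proof -
  have "emeasure (gaussian \<mu> v) A = (\<integral>\<^sup>+x. ennreal (normal_density \<mu> (sqrt v) x) * indicator A x \<partial>lborel)"
    unfolding gaussian_def by (subst emeasure_density) auto
  also have "\<dots> = \<bar>sqrt v\<bar> * (\<integral>\<^sup>+t. ennreal (normal_density \<mu> (sqrt v) (\<mu> + sqrt v * t))
      * indicator A (\<mu> + sqrt v * t) \<partial>lborel)"
    using v by (subst nn_integral_real_affine[where c="sqrt v" and t=\<mu>]) auto
  also have "\<dots> = (\<integral>\<^sup>+t. ennreal (sqrt v) * (ennreal (normal_density \<mu> (sqrt v) (\<mu> + sqrt v * t))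
      * indicator A (\<mu> + sqrt v * t)) \<partial>lborel)"
    using v by (subst nn_integral_cmult) auto
  also have "\<dots> = (\<integral>\<^sup>+t. ennreal (normal_density 0 1 t) * indicator {t. \<mu> + sqrt v * t \<in> A} t \<partial>lborel)"
  proof (intro nn_integral_cong)
    fix t
    have "sqrt v * normal_density \<mu> (sqrt v) (\<mu> + sqrt v * t) = normal_density 0 1 t"
      using v by (simp add: normal_density_def power_mult_distrib real_sqrt_mult)
    then show "ennreal (sqrt v) * (ennreal (normal_density \<mu> (sqrt v) (\<mu> + sqrt v * t))
        * indicator A (\<mu> + sqrt v * t)) =
      ennreal (normal_density 0 1 t) * indicator {t. \<mu> + sqrt v * t \<in> A} t"
      using v by (simp add: mult.assoc[symmetric] ennreal_mult[symmetric] indicator_def)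
  qed
  also have "\<dots> = emeasure (gaussian 0 1) {t. \<mu> + sqrt v * t \<in> A}"
    unfolding gaussian_def by (subst emeasure_density) auto
  finally show ?thesis .
qed

lemma gaussian_singleton: "measure (gaussian \<mu> v) {x} = 0"
proof -
  have "emeasure (gaussian \<mu> v) {x} = (\<integral>\<^sup>+y\<in>{x}. ennreal (normal_density \<mu> (sqrt v) y) \<partial>lborel)"
    unfolding gaussian_def by (subst emeasure_density) auto
  also have "\<dots> = 0"
    by (intro nn_integral_null_set) (simp add: null_sets_def)
  finally show ?thesis by (simp add: measure_def)
qed

text \<open>
  The half-line is open because the strict part of a conformal p-value is the mass of such a half-line.
\<close>

lemma gaussian_lessThan:
  assumes v: "0 < v"
  shows "measure (gaussian \<mu> v) {..<x} = std_normal_cdf ((x - \<mu>) / sqrt v)"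
proof -
  interpret prob_space "gaussian \<mu> v" using v by (rule prob_space_gaussian)
  have eq: "{..x} = {..<x} \<union> {x}" by auto
  have "measure (gaussian \<mu> v) {..x} = measure (gaussian \<mu> v) {..<x}"
    unfolding eq by (subst finite_measure_Union) (auto simp: gaussian_singleton)
  moreover have "{t. \<mu> + sqrt v * t \<in> {..x}} = {..(x - \<mu>) / sqrt v}"
    using v by (auto simp: field_simps)
  ultimately show ?thesis
    using emeasure_gaussian_standardize[OF v, of "{..x}" \<mu>]
    by (simp add: std_normal_cdf_def cdf_def measure_def)
qed

lemma gaussian_atLeastAtMost:
  assumes v: "0 < v" and ab: "a \<le> b"
  shows "measure (gaussian \<mu> v) {a..b}
    = std_normal_cdf ((b - \<mu>) / sqrt v) - std_normal_cdf ((a - \<mu>) / sqrt v)"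
proof -
  interpret prob_space "gaussian \<mu> v" using v by (rule prob_space_gaussian)
  have eq: "{..<a} \<union> {a..b} = {..<b} \<union> {b}" using ab by auto
  have "measure (gaussian \<mu> v) {..<a} + measure (gaussian \<mu> v) {a..b} = measure (gaussian \<mu> v) {..<b}"
    by (subst finite_measure_Union[symmetric], simp, simp, force, subst eq,
        subst finite_measure_Union) (auto simp: gaussian_singleton)
  then show ?thesis using v by (simp add: gaussian_lessThan)
qed

text \<open>
  The density vanishes nowhere, so every nondegenerate interval has positive mass.
\<close>

lemma strict_mono_std_normal_cdf: "strict_mono std_normal_cdf"
proof (rule strict_monoI)
  fix a b :: real assume ab: "a < b"
  interpret prob_space "gaussian 0 1" by (rule prob_space_gaussian) simp
  have "emeasure (gaussian 0 1) {a..b} \<noteq> 0"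
  proof
    assume "emeasure (gaussian 0 1) {a..b} = 0"
    then have "AE x in lborel. ennreal (normal_density 0 1 x) * indicator {a..b} x = 0"
      unfolding gaussian_def by (simp add: emeasure_density nn_integral_0_iff_AE)
    then have "AE x in lborel. x \<notin> {a..b}"
    proof eventually_elim
      case (elim x)
      then show ?case using normal_density_pos[of 1 0 x] by (auto simp: indicator_def)
    qed
    then have "emeasure lborel {a..b} = 0"
      by (subst (asm) AE_iff_measurable[where N="{a..b}"]) auto
    then show False using ab by simp
  qed
  then have "0 < measure (gaussian 0 1) {a..b}"
    by (simp add: emeasure_eq_measure less_le)
  then show "std_normal_cdf a < std_normal_cdf b"
    using gaussian_atLeastAtMost[of 1 a b 0] ab by simp
qed

lemma std_normal_cdf_unit: "std_normal_cdf x \<in> {0..1}"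
proof -
  interpret real_distribution "gaussian 0 1" by (rule real_distribution_gaussian) simp
  show ?thesis by (simp add: std_normal_cdf_def cdf_nonneg cdf_bounded_prob)
qed

section \<open>The second conformal p-value\<close>

text \<open>
  The hyperplane measure is parametrised by the first coordinate; the reflection \<open>t \<mapsto> \<sigma> - t\<close> switches
  to the last one, whose law is wanted. The factor \<open>sqrt 2\<close> is the area element, and cancels
  in the normalisation below.
\<close>

lemma nn_integral_hyperplane_lebesgue_2:
  fixes g :: "real \<times> real \<Rightarrow> ennreal"
  assumes g [measurable]: "g \<in> borel_measurable (borel \<Otimes>\<^sub>M borel)"
  shows "(\<integral>\<^sup>+z. g (z 1, z 2) \<partial>hyperplane_lebesgue 2 \<sigma>) =
    ennreal (sqrt 2) * (\<integral>\<^sup>+t. g (\<sigma> - t, t) \<partial>lborel)"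
proof -
  let ?R = "restrict_space (\<Pi>\<^sub>M i\<in>{1..2::nat}. borel :: real measure) (hyperplane 2 \<sigma>)"
  let ?h = "\<lambda>x :: nat \<Rightarrow> real. x(2 := \<sigma> - (\<Sum>i\<in>{1..<2}. x i))"
  interpret product_sigma_finite "\<lambda>i :: nat. lborel :: real measure" by standard
  have one: "{Suc 0..<2} = {1}" and two: "{Suc 0..2} = {1, 2}" by auto
  have gR [measurable]: "(\<lambda>z. g (z 1, z 2)) \<in> borel_measurable ?R"
    by (intro measurable_restrict_space1) measurable
  have h [measurable]: "?h \<in> (\<Pi>\<^sub>M i\<in>{1..<2}. lborel) \<rightarrow>\<^sub>M ?R"
  proof (rule measurable_restrict_space2)
    show "?h \<in> space (\<Pi>\<^sub>M i\<in>{1..<2}. lborel) \<rightarrow> hyperplane 2 \<sigma>"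
      by (auto simp: hyperplane_def summary_def space_PiM PiE_def extensional_def one two)
    have "insert 2 {1..<2} = {1..2::nat}" by auto
    moreover have "?h \<in> (\<Pi>\<^sub>M i\<in>{1..<2}. lborel) \<rightarrow>\<^sub>M (\<Pi>\<^sub>M i\<in>insert 2 {1..<2}. borel :: real measure)"
      by (intro measurable_fun_upd[where J="{1..<2}"]) (auto simp: measurable_ident_sets one
          intro!: measurable_ident_sets sets_PiM_cong borel_measurable_diff)
    ultimately show "?h \<in> (\<Pi>\<^sub>M i\<in>{1..<2}. lborel) \<rightarrow>\<^sub>M (\<Pi>\<^sub>M i\<in>{1..2::nat}. borel :: real measure)"
      by simp
  qed
  have "(\<integral>\<^sup>+z. g (z 1, z 2) \<partial>hyperplane_lebesgue 2 \<sigma>) =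
      ennreal (sqrt 2) * (\<integral>\<^sup>+x. g (?h x 1, ?h x 2) \<partial>(\<Pi>\<^sub>M i\<in>{1..<2}. lborel))"
    unfolding hyperplane_lebesgue_def
    by (subst nn_integral_scale_measure, simp only: measurable_distr_eq1 gR,
        subst nn_integral_distr[OF h], simp only: measurable_distr_eq1 gR, simp)
  also have "(\<integral>\<^sup>+x. g (?h x 1, ?h x 2) \<partial>(\<Pi>\<^sub>M i\<in>{1..<2}. lborel)) =
      (\<integral>\<^sup>+x. (\<lambda>t. g (t, \<sigma> - t)) (x 1) \<partial>(\<Pi>\<^sub>M i\<in>{1::nat}. lborel))"
    by (simp add: one)
  also have "\<dots> = (\<integral>\<^sup>+t. g (t, \<sigma> - t) \<partial>lborel)"
    by (rule product_nn_integral_singleton) simp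
  also have "\<dots> = (\<integral>\<^sup>+t. g (\<sigma> - t, t) \<partial>lborel)"
    by (subst nn_integral_real_affine[where c="-1" and t=\<sigma>]) auto
  finally show ?thesis .
qed

text \<open>
  Completing the square, \<open>((\<sigma> - t)\<^sup>2 + t\<^sup>2) / 2 = \<sigma>\<^sup>2 / 4 + (t - \<sigma> / 2)\<^sup>2\<close>.
\<close>

lemma last_coordinate_law_2: "last_coordinate_law 2 \<sigma> = gaussian (\<sigma> / 2) (1 / 2)"
proof (rule measure_eqI)
  show "sets (last_coordinate_law 2 \<sigma>) = sets (gaussian (\<sigma> / 2) (1 / 2))"
    by (simp add: last_coordinate_law_def)
  fix B assume "B \<in> sets (last_coordinate_law 2 \<sigma>)"
  then have B [measurable]: "B \<in> sets borel" by (simp add: last_coordinate_law_def)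
  let ?H = "hyperplane_lebesgue 2 \<sigma>"
  let ?d = "normal_density (\<sigma> / 2) (sqrt (1 / 2))"
  define w :: "real \<times> real \<Rightarrow> ennreal" where "w = (\<lambda>(a, b). ennreal (exp (- (1/2) * (a\<^sup>2 + b\<^sup>2))))"
  \<comment> \<open>the ratio of the weight to the density of the mean \<open>\<sigma> / 2\<close>, variance \<open>1 / 2\<close> Gaussian\<close>
  define C where "C = exp (- \<sigma>\<^sup>2 / 4) * sqrt pi"
  have Cpos: "0 < C" by (simp add: C_def)
  have [measurable]: "w \<in> borel_measurable (borel \<Otimes>\<^sub>M borel)"
    unfolding w_def by measurable
  have two: "{Suc 0..2} = {1, 2}" by auto
  have weight: "gaussian_weight 2 = (\<lambda>z. w (z 1, z 2))"
    by (auto simp: gaussian_weight_def w_def two fun_eq_iff)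
  have setsH: "sets ?H = sets (restrict_space (\<Pi>\<^sub>M i\<in>{1..2}. borel) (hyperplane 2 \<sigma>))"
    by (simp add: hyperplane_lebesgue_def)
  have z1 [measurable]: "(\<lambda>z. z 1) \<in> borel_measurable ?H"
    and z2 [measurable]: "(\<lambda>z. z 2) \<in> borel_measurable ?H"
    unfolding measurable_cong_sets[OF setsH refl]
    by (intro measurable_restrict_space1 measurable_component_singleton; simp)+
  have wt: "w (\<sigma> - t, t) = ennreal C * ennreal (?d t)" for t
  proof -
    have "exp (- (1/2) * ((\<sigma> - t)\<^sup>2 + t\<^sup>2)) = exp (- \<sigma>\<^sup>2 / 4) * exp (- (t - \<sigma> / 2)\<^sup>2)"
      unfolding exp_add[symmetric] by (simp add: power2_eq_square field_simps)
    also have "\<dots> = C * ?d t"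
      by (simp add: C_def normal_density_def real_sqrt_divide power_divide)
    finally show ?thesis using Cpos by (simp add: w_def ennreal_mult)
  qed
  have gauss: "(\<integral>\<^sup>+t. w (\<sigma> - t, t) * indicator D t \<partial>lborel)
      = ennreal C * emeasure (gaussian (\<sigma> / 2) (1 / 2)) D" if [measurable]: "D \<in> sets borel" for D
  proof -
    have "(\<integral>\<^sup>+t. w (\<sigma> - t, t) * indicator D t \<partial>lborel)
        = ennreal C * (\<integral>\<^sup>+t. ennreal (?d t) * indicator D t \<partial>lborel)"
      by (subst nn_integral_cmult[symmetric]) (auto simp: wt mult.assoc)
    then show ?thesis unfolding gaussian_def by (subst emeasure_density) auto
  qed
  interpret G: prob_space "gaussian (\<sigma> / 2) (1 / 2)" by (rule prob_space_gaussian) simp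
  define Z where "Z = (\<integral>\<^sup>+y. gaussian_weight 2 y \<partial>?H)"
  have Z: "Z = ennreal (sqrt 2) * ennreal C"
    unfolding Z_def weight using gauss[of UNIV] G.emeasure_space_1
    by (simp add: nn_integral_hyperplane_lebesgue_2 del: One_nat_def)
  have "emeasure (last_coordinate_law 2 \<sigma>) B =
      (\<integral>\<^sup>+z. w (z 1, z 2) / Z * indicator B (z 2) \<partial>?H)"
  proof -
    have m: "(\<lambda>z. z 2) \<in> compression 2 \<sigma> \<rightarrow>\<^sub>M borel"
      unfolding compression_def by simp
    have "emeasure (last_coordinate_law 2 \<sigma>) B
        = emeasure (compression 2 \<sigma>) ((\<lambda>z. z 2) -` B \<inter> space ?H)"
      unfolding last_coordinate_law_def
      by (subst emeasure_distr[OF m B]) (simp add: compression_def)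
    also have "\<dots> = (\<integral>\<^sup>+z. w (z 1, z 2) / Z * indicator ((\<lambda>z. z 2) -` B \<inter> space ?H) z \<partial>?H)"
      unfolding compression_def Z_def[symmetric] unfolding weight
      by (subst emeasure_density) (auto simp del: One_nat_def)
    also have "\<dots> = (\<integral>\<^sup>+z. w (z 1, z 2) / Z * indicator B (z 2) \<partial>?H)"
      by (intro nn_integral_cong) (auto simp: indicator_def)
    finally show ?thesis .
  qed
  also have "\<dots> = (\<integral>\<^sup>+z. (\<lambda>(a, b). w (a, b) * indicator B b / Z) (z 1, z 2) \<partial>?H)"
    by (intro nn_integral_cong) (auto simp: indicator_def)
  also have "\<dots> = ennreal (sqrt 2) * (\<integral>\<^sup>+t. w (\<sigma> - t, t) * indicator B t / Z \<partial>lborel)"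
    by (subst nn_integral_hyperplane_lebesgue_2) auto
  also have "\<dots> = ennreal (sqrt 2) * (ennreal C * emeasure (gaussian (\<sigma> / 2) (1 / 2)) B / Z)"
    by (subst nn_integral_divide) (auto simp: gauss)
  also have "\<dots> = Z * emeasure (gaussian (\<sigma> / 2) (1 / 2)) B / Z"
    by (simp add: Z ennreal_times_divide mult.assoc)
  also have "\<dots> = emeasure (gaussian (\<sigma> / 2) (1 / 2)) B"
    using Cpos by (subst mult.commute, intro ennreal_mult_divide_eq)
      (auto simp: Z ennreal_mult_eq_top_iff)
  finally show "emeasure (last_coordinate_law 2 \<sigma>) B = emeasure (gaussian (\<sigma> / 2) (1 / 2)) B" .
qed

lemma conformal_p_2:
  "conformal_p identity_conformity z \<tau> 2 = std_normal_cdf ((z 2 - z 1) / sqrt 2)"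
proof -
  have two: "{Suc 0..2} = {1, 2}" by auto
  have "(z 2 - summary 2 z / 2) / sqrt (1 / 2) = (z 2 - z 1) / sqrt 2"
    by (simp add: summary_def two real_sqrt_divide field_simps flip: mult.assoc)
  moreover have "{y. y < z 2} = {..<z 2}" "{y. y = z 2} = {z 2}" by auto
  ultimately show ?thesis
    by (simp add: conformal_p_def Let_def identity_conformity_def last_coordinate_law_2
        gaussian_singleton gaussian_lessThan)
qed

lemma gaussian_0_2_unit_interval:
  "measure (gaussian 0 2) {-1..1} = std_normal_cdf (1 / sqrt 2) - std_normal_cdf (- 1 / sqrt 2)"
  by (subst gaussian_atLeastAtMost) auto

lemma gaussian_0_2_unit_interval_pos: "0 < measure (gaussian 0 2) {-1..1}"
  unfolding gaussian_0_2_unit_interval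
  using strict_monoD[OF strict_mono_std_normal_cdf, of "- 1 / sqrt 2" "1 / sqrt 2"] by simp

lemma S_obs_eq:
  assumes "2 \<le> n"
  shows "S_obs \<tau> n z = (if z 2 - z 1 \<in> {-1..1} then 1 / measure (gaussian 0 2) {-1..1} else 0)"
proof -
  have "std_normal_cdf ((z 2 - z 1) / sqrt 2)
        \<in> {std_normal_cdf (- 1 / sqrt 2) .. std_normal_cdf (1 / sqrt 2)} \<longleftrightarrow> z 2 - z 1 \<in> {-1..1}"
    by (simp add: strict_mono_less_eq[OF strict_mono_std_normal_cdf] divide_le_cancel
        del: divide_minus_left)
  then show ?thesis
    using assms unfolding S_obs_def S_conf_def conformal_p_2 by auto
qed

section \<open>Coordinate filtrations and martingales\<close>

text \<open>
  All the independence that is used, under the uniform as well as under the Gaussian product measure.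
\<close>

lemma measure_PiM_rectangle:
  fixes M :: "nat \<Rightarrow> 'a measure"
  assumes "\<And>i. prob_space (M i)" and AB: "A \<in> sets (M 1)" "B \<in> sets (M 2)"
  shows "measure (Pi\<^sub>M {1..} M) {x \<in> space (Pi\<^sub>M {1..} M). x 1 \<in> A \<and> x 2 \<in> B}
    = measure (M 1) A * measure (M 2) B"
proof -
  interpret M: prob_space "M i" for i by fact
  interpret product_prob_space M "{1..}" by standard
  let ?X = "\<lambda>i::nat. if i = 1 then A else B"
  have "emeasure (Pi\<^sub>M {1..} M) {x \<in> space (Pi\<^sub>M {1..} M). \<forall>i\<in>{1, 2}. x i \<in> ?X i}
      = (\<Prod>i\<in>{1, 2}. emeasure (M i) (?X i))"
    using AB by (intro emeasure_PiM_Collect) auto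
  then show ?thesis
    by (simp add: measure_def enn2real_mult)
qed

lemma space_coordinate_filtration [simp]: "space (coordinate_filtration \<Omega> n) = \<Omega>"
  by (simp add: coordinate_filtration_def space_measure_of_conv)

lemma sets_coordinate_filtration:
  "sets (coordinate_filtration \<Omega> n) =
    sigma_sets \<Omega> {{x \<in> \<Omega>. x i \<in> B} | i B. i \<in> {1..n} \<and> B \<in> sets borel}"
  unfolding coordinate_filtration_def by (rule sets_measure_of) blast

lemma subalgebra_coordinate_filtration:
  assumes meas: "\<And>i. i \<in> {1..} \<Longrightarrow> (\<lambda>x. x i) \<in> borel_measurable P"
  shows "subalgebra P (coordinate_filtration (space P) n)"
  unfolding subalgebra_def
proof (intro conjI)
  have "{x \<in> space P. x i \<in> B} \<in> sets P" if "i \<in> {1..n}" "B \<in> sets borel" for i B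
  proof -
    have "(\<lambda>x. x i) -` B \<inter> space P \<in> sets P"
      using that by (intro measurable_sets[OF meas]) simp_all
    also have "(\<lambda>x. x i) -` B \<inter> space P = {x \<in> space P. x i \<in> B}" by blast
    finally show ?thesis .
  qed
  then show "sets (coordinate_filtration (space P) n) \<subseteq> sets P"
    unfolding sets_coordinate_filtration by (intro sets.sigma_sets_subset) blast
qed simp

lemma filtration_coordinate_filtration: "filtration \<Omega> (coordinate_filtration \<Omega>)"
proof
  fix i j :: nat assume "i \<le> j"
  then have "{1..i} \<subseteq> {1..j}" by simp
  then show "sets (coordinate_filtration \<Omega> i) \<subseteq> sets (coordinate_filtration \<Omega> j)"
    unfolding sets_coordinate_filtration by (intro sigma_sets_mono') blast
qed simp

lemma coordinate_filtration_generator: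
  assumes "i \<in> {1..n}" "B \<in> sets borel"
  shows "{x \<in> \<Omega>. x i \<in> B} \<in> sets (coordinate_filtration \<Omega> n)"
  unfolding sets_coordinate_filtration using assms by (intro sigma_sets.Basic) blast

lemma measurable_coordinate_filtration:
  assumes "i \<in> {1..n}"
  shows "(\<lambda>x. x i) \<in> borel_measurable (coordinate_filtration \<Omega> n)"
proof (rule measurableI)
  fix B :: "real set" assume "B \<in> sets borel"
  then show "(\<lambda>x. x i) -` B \<inter> space (coordinate_filtration \<Omega> n) \<in> sets (coordinate_filtration \<Omega> n)"
    using coordinate_filtration_generator[OF assms, of B \<Omega>]
    by (simp add: vimage_def Int_def conj_commute)
qed simp

text \<open>
  Up to time 1 only one coordinate has been seen, and the cylinders over it already form a
  \<open>\<sigma>\<close>-algebra. This makes the events at that time explicit enough for the rectangle formula.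
\<close>

lemma sets_coordinate_filtration_le_1:
  assumes "m \<le> 1" "A \<in> sets (coordinate_filtration \<Omega> m)"
  shows "\<exists>B\<in>sets borel. A = {x \<in> \<Omega>. x 1 \<in> B}"
proof -
  have "A \<in> sigma_sets \<Omega> {{x \<in> \<Omega>. x i \<in> B} |i B. i \<in> {1..m} \<and> B \<in> sets borel}"
    using assms(2) unfolding sets_coordinate_filtration .
  then show ?thesis
  proof induction
    case (Basic a)
    then obtain i B where a: "a = {x \<in> \<Omega>. x i \<in> B}" and i: "i \<in> {1..m}" and B: "B \<in> sets borel"
      by auto
    from i \<open>m \<le> 1\<close> have "i = 1" by auto
    with a B show ?case by (intro bexI[of _ B]) simp_all
  next
    case Empty
    then show ?case by (intro bexI[of _ "{}"]) auto
  next
    case (Compl a)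
    then obtain B where "B \<in> sets borel" "a = {x \<in> \<Omega>. x 1 \<in> B}" by auto
    then show ?case by (intro bexI[of _ "- B"]) (auto simp del: One_nat_def)
  next
    case (Union a)
    then have "\<forall>i. \<exists>B. B \<in> sets borel \<and> a i = {x \<in> \<Omega>. x 1 \<in> B}" by blast
    then obtain B where "\<forall>i. B i \<in> sets borel \<and> a i = {x \<in> \<Omega>. x 1 \<in> B i}"
      unfolding choice_iff by blast
    then show ?case by (intro bexI[of _ "\<Union>i. B i"]) auto
  qed
qed

lemma martingale_set_integral:
  assumes "is_martingale P G S" "m \<le> n" and A: "A \<in> sets (G m)"
  shows "(\<integral>x\<in>A. S n x \<partial>P) = (\<integral>x\<in>A. S m x \<partial>P)"
proof -
  have "prob_space P" and sub: "subalgebra P (G m)" and int: "integrable P (S n)"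
    and AE: "AE x in P. real_cond_exp P (G m) (S n) x = S m x"
    and meas: "S m \<in> borel_measurable P"
    using assms by (auto simp: is_martingale_def)
  interpret prob_space P by fact
  interpret finite_measure_subalgebra P "G m" by standard (rule sub)
  have [measurable]: "A \<in> sets P" using A sub by (auto simp: subalgebra_def)
  note [measurable] = meas
  have "(\<integral>x\<in>A. S n x \<partial>P) = (\<integral>x\<in>A. real_cond_exp P (G m) (S n) x \<partial>P)"
    using int A by (rule real_cond_exp_intA)
  also have "\<dots> = (\<integral>x\<in>A. S m x \<partial>P)"
    unfolding set_lebesgue_integral_def using AE by (intro integral_cong_AE) auto
  finally show ?thesis .
qed

section \<open>The bet on the second p-value is fair\<close>

lemma prob_space_uniform: "prob_space (restrict_space lborel {0..1 :: real})"
  by (intro prob_spaceI) (simp add: emeasure_restrict_space space_restrict_space)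

lemma measure_uniform_interval:
  assumes "0 \<le> a" "a \<le> b" "b \<le> (1 :: real)"
  shows "measure (restrict_space lborel {0..1}) {a..b} = b - a"
  using assms by (subst measure_restrict_space) auto

lemma measurable_uniform_seq_component:
  assumes "i \<in> {1..}"
  shows "(\<lambda>x. x i) \<in> borel_measurable uniform_seq"
proof -
  have "(\<lambda>x. x i) \<in> uniform_seq \<rightarrow>\<^sub>M restrict_space lborel {0..1}"
    unfolding uniform_seq_def using assms by (rule measurable_component_singleton)
  moreover have "(\<lambda>t. t) \<in> restrict_space lborel {0..1 :: real} \<rightarrow>\<^sub>M borel"
    by (intro measurable_restrict_space1) simp
  ultimately show ?thesis by (rule measurable_compose)
qed

text \<open>
  The process moves only between times 1 and 2, so the martingale property needs an argument only for
  \<open>m \<le> 1\<close> and \<open>n \<ge> 2\<close>. There the event \<open>p\<^sub>2 \<in> I\<close> is independent of the past, and its probability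
  is the length of \<open>I\<close>, which is the normalising constant \<open>c\<close>.
\<close>

lemma conformal_test_martingale_S_conf: "conformal_test_martingale S_conf"
proof -
  define c where "c = measure (gaussian 0 2) {-1..1}"
  define I where "I = {std_normal_cdf (- 1 / sqrt 2) .. std_normal_cdf (1 / sqrt 2)}"
  let ?\<Omega> = "space uniform_seq"
  let ?G = "coordinate_filtration ?\<Omega>"
  let ?U = "restrict_space lborel {0..1 :: real}"
  have c: "0 < c" unfolding c_def by (rule gaussian_0_2_unit_interval_pos)
  interpret P: prob_space uniform_seq
    unfolding uniform_seq_def by (intro prob_space_PiM prob_space_uniform)
  note [measurable] = measurable_uniform_seq_component
  have sub: "subalgebra uniform_seq (?G n)" for n
    by (rule subalgebra_coordinate_filtration) simp
  interpret sub: finite_measure_subalgebra uniform_seq "?G n" for n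
    by standard (rule sub)
  have I01: "I \<subseteq> {0..1}"
    using std_normal_cdf_unit[of "- 1 / sqrt 2"] std_normal_cdf_unit[of "1 / sqrt 2"]
    unfolding I_def by auto
  have UI: "measure ?U I = c"
    unfolding I_def c_def gaussian_0_2_unit_interval
    using std_normal_cdf_unit[of "- 1 / sqrt 2"] std_normal_cdf_unit[of "1 / sqrt 2"]
      gaussian_0_2_unit_interval_pos[unfolded gaussian_0_2_unit_interval]
    by (intro measure_uniform_interval) auto
  have S_small: "S_conf n = (\<lambda>_. 1)" if "n \<le> 1" for n
    using that by (simp add: S_conf_def fun_eq_iff)
  have S_large: "S_conf n = (\<lambda>p. indicator I (p 2) / c)" if "2 \<le> n" for n
    using that by (auto simp: S_conf_def fun_eq_iff I_def c_def)
  have adapted: "S_conf n \<in> borel_measurable (?G n)" for n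
  proof (cases "n \<le> 1")
    case False
    then have "(\<lambda>p. p 2) \<in> borel_measurable (?G n)"
      by (intro measurable_coordinate_filtration) auto
    then have "(\<lambda>p. indicator I (p 2) / c) \<in> borel_measurable (?G n)"
      unfolding I_def by measurable
    with False show ?thesis by (simp add: S_large)
  qed (simp add: S_small)
  have int: "integrable uniform_seq (S_conf n)" for n
  proof (rule P.integrable_const_bound[where B="max 1 (1 / c)"])
    show "S_conf n \<in> borel_measurable uniform_seq"
      using adapted sub by (rule measurable_from_subalg[rotated])
    show "AE p in uniform_seq. norm (S_conf n p) \<le> max 1 (1 / c)"
      using c by (cases "n \<le> 1") (auto simp: S_small S_large indicator_def)
  qed
  have cond: "AE p in uniform_seq. real_cond_exp uniform_seq (?G m) (S_conf n) p = S_conf m p"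
    if mn: "m \<le> n" for m n
  proof (cases "n \<le> 1 \<or> 2 \<le> m")
    case True
    then have "S_conf n = S_conf m" using mn by (auto simp: S_small S_large)
    then show ?thesis using int[of m] adapted[of m] by simp
  next
    case False
    then have m: "m \<le> 1" and n: "2 \<le> n" by auto
    show ?thesis
    proof (rule sub.real_cond_exp_charact)
      fix A assume "A \<in> sets (?G m)"
      then obtain B where B [measurable]: "B \<in> sets borel" and A: "A = {p \<in> ?\<Omega>. p 1 \<in> B}"
        using sets_coordinate_filtration_le_1[OF m] by blast
      let ?R = "\<lambda>J. {p \<in> ?\<Omega>. p 1 \<in> B \<inter> {0..1} \<and> p 2 \<in> J}"
      have rect: "P.prob (?R J) = measure ?U (B \<inter> {0..1}) * measure ?U J" if "J \<in> sets ?U" for J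
        unfolding uniform_seq_def using that
        by (intro measure_PiM_rectangle prob_space_uniform) (auto simp: sets_restrict_space)
      have range: "p i \<in> {0..1}" if "p \<in> ?\<Omega>" "1 \<le> i" for p i
      proof -
        have "p \<in> {1..} \<rightarrow>\<^sub>E {0..1}"
          using that(1) by (simp add: uniform_seq_def space_PiM space_restrict_space)
        from PiE_mem[OF this, of i] that(2) show ?thesis by simp
      qed
      have [measurable]: "I \<in> sets borel" by (simp add: I_def)
      have IU: "I \<in> sets ?U" using I01 by (auto simp: sets_restrict_space_iff)
      have A1: "A = ?R {0..1}"
        unfolding A using range[of _ 1] range[of _ 2] by auto
      have RI: "?R I = {p \<in> ?\<Omega>. p 1 \<in> B \<and> p 2 \<in> I}"
        using range[of _ 1] by auto
      have RIs: "?R I \<in> sets uniform_seq" unfolding RI by measurable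
      have As: "A \<in> sets uniform_seq" unfolding A by measurable
      have "(\<integral>p\<in>A. S_conf n p \<partial>uniform_seq) = (\<integral>p. indicator (?R I) p / c \<partial>uniform_seq)"
        unfolding set_lebesgue_integral_def S_large[OF n] RI A
        by (intro Bochner_Integration.integral_cong) (auto simp: indicator_def)
      also have "\<dots> = P.prob (?R I) / c" using RIs by simp
      also have "\<dots> = measure ?U (B \<inter> {0..1})"
        unfolding rect[OF IU] UI using c by simp
      also have "\<dots> = P.prob A"
        unfolding A1 using measure_uniform_interval[of 0 1]
        by (subst rect) (auto simp: sets_restrict_space_iff)
      also have "\<dots> = (\<integral>p\<in>A. S_conf m p \<partial>uniform_seq)"
        using As by (simp add: S_small[OF m] set_lebesgue_integral_def)
      finally show "(\<integral>p\<in>A. S_conf n p \<partial>uniform_seq) = (\<integral>p\<in>A. S_conf m p \<partial>uniform_seq)" .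
    qed (rule int adapted)+
  qed
  show ?thesis
    unfolding conformal_test_martingale_def test_martingale_def is_martingale_def
  proof (intro conjI allI impI ballI)
    show "0 \<le> S_conf n p" for n p
      using c by (simp add: S_conf_def c_def)
  qed (simp_all add: P.prob_space_axioms filtration_coordinate_filtration sub adapted int cond S_small)
qed

section \<open>No natural test martingale dominates the bet\<close>

text \<open>
  The conditional probability of \<open>\<bar>z\<^sub>2 - z\<^sub>1\<bar> \<le> 1\<close> given \<open>z\<^sub>1\<close> need not be computed. If \<open>z\<^sub>1\<close> is within
  \<open>1/5\<close> of \<open>\<mu>\<close> and \<open>z\<^sub>2\<close> within \<open>4/5\<close>, then \<open>\<bar>z\<^sub>2 - z\<^sub>1\<bar> \<le> 1\<close>, so the probability is bounded below by
  \<open>\<Phi> (4/5) - \<Phi> (- 4/5)\<close>, and this exceeds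
  \<open>c = \<Phi> (1 / sqrt 2) - \<Phi> (- 1 / sqrt 2)\<close> because \<open>1 / sqrt 2 < 4/5\<close>.
\<close>

lemma no_dominating_test_martingale:
  assumes S: "natural_test_martingale (gaussian_seq \<mu>) S"
    and S1: "\<And>z. z \<in> {1..} \<rightarrow>\<^sub>E UNIV \<Longrightarrow> 1 \<le> S 1 z"
    and S2: "\<And>z. z \<in> {1..} \<rightarrow>\<^sub>E UNIV \<Longrightarrow>
      (if z 2 - z 1 \<in> {-1..1} then 1 / measure (gaussian 0 2) {-1..1} else 0) \<le> S 2 z"
  shows False
proof -
  define c where "c = measure (gaussian 0 2) {-1..1}"
  let ?P = "gaussian_seq \<mu>"
  let ?\<Omega> = "space ?P"
  let ?G = "coordinate_filtration ?\<Omega>"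
  have c: "0 < c" unfolding c_def by (rule gaussian_0_2_unit_interval_pos)
  have \<Omega>: "?\<Omega> = {1..} \<rightarrow>\<^sub>E UNIV" by (simp add: gaussian_seq_def space_PiM)
  have mart: "is_martingale ?P ?G S" and S0: "\<And>z. z \<in> ?\<Omega> \<Longrightarrow> S 0 z = 1"
    and nonneg: "\<And>z. z \<in> ?\<Omega> \<Longrightarrow> 0 \<le> S 2 z"
    using S by (auto simp: natural_test_martingale_def test_martingale_def)
  have int: "integrable ?P (S n)" for n
    using mart by (simp add: is_martingale_def)
  interpret P: prob_space ?P using mart by (simp add: is_martingale_def)
  interpret N: prob_space "gaussian \<mu> 1" by (rule prob_space_gaussian) simp
  \<comment> \<open>radii that add up to 1, the second one larger than \<open>1 / sqrt 2\<close>\<close>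
  define A where "A = {\<mu> - 1/5 .. \<mu> + 1/5}"
  define B where "B = {\<mu> - 4/5 .. \<mu> + 4/5}"
  let ?A = "{z \<in> ?\<Omega>. z 1 \<in> A}"
  let ?R = "\<lambda>D. {z \<in> ?\<Omega>. z 1 \<in> A \<and> z 2 \<in> D}"
  have [measurable]: "(\<lambda>z. z i) \<in> borel_measurable ?P" if "i \<in> {1..}" for i
    using measurable_component_singleton[OF that, of "\<lambda>_. gaussian \<mu> 1"]
    by (simp add: gaussian_seq_def cong: measurable_cong_sets)
  have [measurable]: "A \<in> sets borel" "B \<in> sets borel" by (auto simp: A_def B_def)
  have rect: "P.prob (?R D) = measure (gaussian \<mu> 1) A * measure (gaussian \<mu> 1) D"
    if "D \<in> sets borel" for D
    unfolding gaussian_seq_def using that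
    by (intro measure_PiM_rectangle prob_space_gaussian) auto
  have As: "?A \<in> sets ?P" and Rs: "?R B \<in> sets ?P" by measurable
  have AG: "?A \<in> sets (?G 1)"
    by (intro coordinate_filtration_generator) auto

  \<comment> \<open>a random variable that is at least 1 and has expectation 1 is 1 almost surely\<close>
  have "(\<integral>z. S 1 z \<partial>?P) = (\<integral>z. S 0 z \<partial>?P)"
  proof -
    have "?\<Omega> \<in> sets (?G 0)"
      using sets.top[of "?G 0"] by simp
    from martingale_set_integral[OF mart _ this, of 1] show ?thesis
      by (simp add: set_integral_space int)
  qed
  also have "\<dots> = 1"
    using P.prob_space by (subst Bochner_Integration.integral_cong[OF refl S0]) auto
  finally have "(\<integral>z. S 1 z - 1 \<partial>?P) = 0"
    using int P.prob_space by simp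
  then have "AE z in ?P. S 1 z - 1 = 0"
    using S1 \<Omega> int by (subst (asm) integral_nonneg_eq_0_iff_AE) auto
  then have "(\<integral>z\<in>?A. S 1 z \<partial>?P) = (\<integral>z. indicator ?A z \<partial>?P)"
    unfolding set_lebesgue_integral_def
    using As int by (intro integral_cong_AE) auto
  also have "\<dots> = P.prob ?A" using As by simp
  also have "?A = ?R UNIV" by simp
  also have "P.prob (?R UNIV) = measure (gaussian \<mu> 1) A"
    using rect[of UNIV] N.prob_space by simp
  finally have le: "(\<integral>z\<in>?A. S 2 z \<partial>?P) = measure (gaussian \<mu> 1) A"
    using martingale_set_integral[OF mart _ AG, of 2] by simp

  have "measure (gaussian \<mu> 1) A * measure (gaussian \<mu> 1) B / c = (\<integral>z. indicator (?R B) z / c \<partial>?P)"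
    using Rs rect[of B] by simp
  also have "\<dots> \<le> (\<integral>z\<in>?A. S 2 z \<partial>?P)"
    unfolding set_lebesgue_integral_def
  proof (rule integral_mono)
    have "integrable ?P (indicat_real (?R B))"
      by (rule integrable_real_indicator[OF Rs]) (simp add: P.emeasure_eq_measure)
    then show "integrable ?P (\<lambda>z. indicator (?R B) z / c)"
      by (rule integrable_divide)
    show "integrable ?P (\<lambda>z. indicat_real ?A z *\<^sub>R S 2 z)"
      using As int by (rule integrable_mult_indicator)
    fix z assume z: "z \<in> ?\<Omega>"
    show "indicator (?R B) z / c \<le> indicat_real ?A z *\<^sub>R S 2 z"
    proof (cases "z \<in> ?R B")
      case True
      then have "z 2 - z 1 \<in> {-1..1}" by (auto simp: A_def B_def)
      moreover from z have "z \<in> {1..} \<rightarrow>\<^sub>E UNIV" unfolding \<Omega> .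
      ultimately have "1 / c \<le> S 2 z" using S2[of z] unfolding c_def by (simp only: if_True)
      with True show ?thesis by simp
    next
      case False
      then have "indicat_real (?R B) z = 0" by (rule indicator_simps)
      moreover have "0 \<le> indicat_real ?A z *\<^sub>R S 2 z"
        using nonneg[OF z] by (intro scaleR_nonneg_nonneg) auto
      ultimately show ?thesis by simp
    qed
  qed
  finally have "measure (gaussian \<mu> 1) A * measure (gaussian \<mu> 1) B \<le> measure (gaussian \<mu> 1) A * c"
    using c unfolding le by (simp add: field_simps)
  moreover have "0 < measure (gaussian \<mu> 1) A"
    unfolding A_def using strict_monoD[OF strict_mono_std_normal_cdf, of "-1/5" "1/5"]
    by (subst gaussian_atLeastAtMost) auto
  moreover have "c < measure (gaussian \<mu> 1) B"
  proof -
    have "5 / 4 < sqrt 2" by (rule real_less_rsqrt) (simp add: power2_eq_square)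
    then have s: "1 / sqrt 2 < 4 / 5" by (simp add: field_simps)
    then have "std_normal_cdf (1 / sqrt 2) < std_normal_cdf (4 / 5)"
      "std_normal_cdf (- 4 / 5) < std_normal_cdf (- 1 / sqrt 2)"
      by (auto intro!: strict_monoD[OF strict_mono_std_normal_cdf])
    then show ?thesis
      unfolding B_def c_def gaussian_0_2_unit_interval
      by (subst gaussian_atLeastAtMost) auto
  qed
  ultimately show False by simp
qed

theorem mainTheorem1:
  shows "conformal_test_martingale S_conf \<and>
    (\<forall>\<tau> \<in> {1..} \<rightarrow>\<^sub>E {0..1}.
       (\<forall>z \<in> {1..} \<rightarrow>\<^sub>E UNIV. \<forall>n\<ge>2.
          S_obs \<tau> n z =
            (if z 2 - z 1 \<in> {-1..1} then 1 / measure (gaussian 0 2) {-1..1} else 0)) \<and>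
       (\<forall>\<mu>::real. \<not> (\<exists>S\<mu>. natural_test_martingale (gaussian_seq \<mu>) S\<mu> \<and>
          (\<forall>z \<in> {1..} \<rightarrow>\<^sub>E UNIV. \<forall>n \<in> {1, 2}. S_obs \<tau> n z \<le> S\<mu> n z))))"
proof (intro conjI ballI allI impI notI)
  show "conformal_test_martingale S_conf" by (rule conformal_test_martingale_S_conf)
next
  fix \<tau> z :: "nat \<Rightarrow> real" and n :: nat assume "2 \<le> n"
  then show "S_obs \<tau> n z =
      (if z 2 - z 1 \<in> {-1..1} then 1 / measure (gaussian 0 2) {-1..1} else 0)"
    by (rule S_obs_eq)
next
  fix \<tau> :: "nat \<Rightarrow> real" and \<mu> :: real
  assume "\<exists>S. natural_test_martingale (gaussian_seq \<mu>) S \<and>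
    (\<forall>z \<in> {1..} \<rightarrow>\<^sub>E UNIV. \<forall>n \<in> {1, 2}. S_obs \<tau> n z \<le> S n z)"
  then obtain S where S: "natural_test_martingale (gaussian_seq \<mu>) S"
    and dom: "\<And>z n. z \<in> {1..} \<rightarrow>\<^sub>E UNIV \<Longrightarrow> n \<in> {1, 2} \<Longrightarrow> S_obs \<tau> n z \<le> S n z"
    by blast
  show False
  proof (rule no_dominating_test_martingale[OF S])
    fix z :: "nat \<Rightarrow> real" assume z: "z \<in> {1..} \<rightarrow>\<^sub>E UNIV"
    show "1 \<le> S 1 z"
      using dom[OF z, of 1] by (simp add: S_obs_def S_conf_def)
    show "(if z 2 - z 1 \<in> {-1..1} then 1 / measure (gaussian 0 2) {-1..1} else 0) \<le> S 2 z"
      using dom[OF z, of 2] S_obs_eq[of 2 \<tau> z] by simp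
  qed
qed

end
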